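(* Let $\Omega$ be a nonempty finite set, and let $\phi$ be the function mapping each set $A=\{A_1,\dots,A_k\}$ ($k\geq 0$) of subsets of $\Omega$ to the digraph $$\phi(A)=\big(\Omega,\ \{(\alpha,\beta)\in\Omega\times\Omega:\{\alpha,\beta\}\subseteq A_i\text{ for some }i\in\{1,\dots,k\}\}\big).$$ Then $\phi$ is $\operatorname{Sym}(\Omega)$-invariant, and its restriction to the set of all sets of nonempty pairwise disjoint subsets of $\Omega$ is injective. Consequently, letting $\mathcal{O}$ be the set of all labelled digraphs on $\Omega$ (graph backtracking), for all sets $A,B$ of subsets of $\Omega$ the pair of constant functions on $\operatorname{Stacks}(\mathcal{O})$ with images the one-entry stacks $[\sigma(\phi(A))]$ and $[\sigma(\phi(B))]$ is a refiner for $\operatorname{Transp}(A,B)$; and this refiner is perfect whenever $A$ and $B$ are both sets of nonempty pairwise disjoint subsets of $\Omega$.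
   Context: Actions are right actions, written by exponentiation. A digraph on a set $V$ is a pair $(V,A)$ with arc set $A \subseteq V\times V$ (loops allowed); a labelled digraph on $V$ additionally has a label assigned to each vertex and each arc. $\operatorname{Sym}(V)$ acts on (labelled) digraphs on $V$ by renaming vertices (carrying labels along). $\sigma$ denotes the function that turns a digraph on $\Omega$ into a labelled digraph by assigning one fixed label to all of its vertices and arcs. Any action of $\operatorname{Sym}(\Omega)$ on a set induces actions elementwise on its subsets (and so on sets of subsets) and entrywise on finite lists of its elements. A function $f:X\to Y$ between sets on which $\operatorname{Sym}(\Omega)$ acts is $\operatorname{Sym}(\Omega)$-invariant if $f(x^g)=f(x)^g$ for all $x\in X$, $g\in\operatorname{Sym}(\Omega)$. For a set $\mathcal{O}$ on which $\operatorname{Sym}(\Omega)$ acts, $\operatorname{Stacks}(\mathcal{O})$ is the set of all finite lists (including the empty one) with entries in $\mathcal{O}$; $|S|$ is length and $\Vert$ is concatenation. $\operatorname{Transp}(x,y) = \{g\in\operatorname{Sym}(\Omega) : x^g=y\}$. A refiner for $U\subseteq\operatorname{Sym}(\Omega)$ (with respect to $\mathcal{O}$) is a pair $(f_L,f_R)$ of functions from $\operatorname{Stacks}(\mathcal{O})$ to itself such that $U\cap\operatorname{Transp}(S,T)\subseteq\operatorname{Transp}(f_L(S),f_R(T))$ for all $S,T$. It is perfect if $U\cap\operatorname{Transp}(S,T)=\operatorname{Transp}(S\Vert f_L(S),\,T\Vert f_R(T))$ for all $S,T$ with $|S|=|T|$. *)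

theory Defs
  imports Main "HOL-Library.Disjoint_Sets" "HOL-Combinatorics.Permutations"
begin

(* Right actions are functions of a point and a permutation, in this order:
   "act x g" is x^g.  Elements of Sym(Omega) are the total functions that permute Omega
   and fix everything outside it. *)
type_synonym ('x, 'a) action = "'x \<Rightarrow> ('a \<Rightarrow> 'a) \<Rightarrow> 'x"

definition Sym :: "'a set \<Rightarrow> ('a \<Rightarrow> 'a) set" where
  "Sym \<Omega> = {g. g permutes \<Omega>}"

definition point_act :: "('a, 'a) action" where
  "point_act \<alpha> g = g \<alpha>"

definition set_act :: "('x, 'a) action \<Rightarrow> ('x set, 'a) action" where
  "set_act act X g = (\<lambda>x. act x g) ` X"

definition list_act :: "('x, 'a) action \<Rightarrow> ('x list, 'a) action" where
  "list_act act xs g = map (\<lambda>x. act x g) xs"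

definition Sym_invariant ::
  "'a set \<Rightarrow> 'x set \<Rightarrow> ('x, 'a) action \<Rightarrow> 'y set \<Rightarrow> ('y, 'a) action \<Rightarrow> ('x \<Rightarrow> 'y) \<Rightarrow> bool" where
  "Sym_invariant \<Omega> X actX Y actY f \<longleftrightarrow>
     f \<in> X \<rightarrow> Y \<and> (\<forall>x\<in>X. \<forall>g\<in>Sym \<Omega>. f (actX x g) = actY (f x) g)"

definition Transp :: "'a set \<Rightarrow> ('x, 'a) action \<Rightarrow> 'x \<Rightarrow> 'x \<Rightarrow> ('a \<Rightarrow> 'a) set" where
  "Transp \<Omega> act x y = {g \<in> Sym \<Omega>. act x g = y}"

type_synonym 'a digraph = "'a set \<times> ('a \<times> 'a) set"

definition digraphs_on :: "'a set \<Rightarrow> 'a digraph set" where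
  "digraphs_on V = {(W, A). W = V \<and> A \<subseteq> V \<times> V}"

definition digraph_act :: "('a digraph, 'a) action" where
  "digraph_act = (\<lambda>(V, A) g. (g ` V, map_prod g g ` A))"

(* The two partial functions are the vertex and the arc labelling; they are defined exactly
   on the vertices and on the arcs, so that equality is equality of labelled digraphs. *)
type_synonym ('a, 'l) labelled_digraph = "'a digraph \<times> ('a \<rightharpoonup> 'l) \<times> ('a \<times> 'a \<rightharpoonup> 'l)"

definition labelled_digraphs_on :: "'a set \<Rightarrow> ('a, 'l) labelled_digraph set" where
  "labelled_digraphs_on V =
     {((W, A), vl, al). (W, A) \<in> digraphs_on V \<and> dom vl = W \<and> dom al = A}"

(* Labels are carried along: the label of x^g in the image is the label of x. *)
definition labelled_digraph_act :: "(('a, 'l) labelled_digraph, 'a) action" where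
  "labelled_digraph_act =
     (\<lambda>(\<Gamma>, vl, al) g. (digraph_act \<Gamma> g, vl \<circ> inv g, al \<circ> map_prod (inv g) (inv g)))"

definition \<sigma> :: "'l \<Rightarrow> 'a digraph \<Rightarrow> ('a, 'l) labelled_digraph" where
  "\<sigma> c = (\<lambda>(V, A). ((V, A), (\<lambda>v. if v \<in> V then Some c else None),
                             (\<lambda>e. if e \<in> A then Some c else None)))"

abbreviation Stacks :: "'x set \<Rightarrow> 'x list set" where
  "Stacks \<O> \<equiv> lists \<O>"

definition refiner ::
  "'a set \<Rightarrow> 'x set \<Rightarrow> ('x, 'a) action \<Rightarrow> ('a \<Rightarrow> 'a) set
     \<Rightarrow> ('x list \<Rightarrow> 'x list) \<times> ('x list \<Rightarrow> 'x list) \<Rightarrow> bool" where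
  "refiner \<Omega> \<O> act U = (\<lambda>(fL, fR).
     U \<subseteq> Sym \<Omega> \<and>
     fL \<in> Stacks \<O> \<rightarrow> Stacks \<O> \<and> fR \<in> Stacks \<O> \<rightarrow> Stacks \<O> \<and>
     (\<forall>S\<in>Stacks \<O>. \<forall>T\<in>Stacks \<O>.
        U \<inter> Transp \<Omega> (list_act act) S T \<subseteq> Transp \<Omega> (list_act act) (fL S) (fR T)))"

definition perfect_refiner ::
  "'a set \<Rightarrow> 'x set \<Rightarrow> ('x, 'a) action \<Rightarrow> ('a \<Rightarrow> 'a) set
     \<Rightarrow> ('x list \<Rightarrow> 'x list) \<times> ('x list \<Rightarrow> 'x list) \<Rightarrow> bool" where
  "perfect_refiner \<Omega> \<O> act U = (\<lambda>(fL, fR).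
     refiner \<Omega> \<O> act U (fL, fR) \<and>
     (\<forall>S\<in>Stacks \<O>. \<forall>T\<in>Stacks \<O>. length S = length T \<longrightarrow>
        U \<inter> Transp \<Omega> (list_act act) S T
          = Transp \<Omega> (list_act act) (S @ fL S) (T @ fR T)))"

definition \<phi> :: "'a set \<Rightarrow> 'a set set \<Rightarrow> 'a digraph" where
  "\<phi> \<Omega> A = (\<Omega>, {(\<alpha>, \<beta>) \<in> \<Omega> \<times> \<Omega>. \<exists>X\<in>A. {\<alpha>, \<beta>} \<subseteq> X})"

definition nonempty_disjoint_families :: "'a set \<Rightarrow> 'a set set set" where
  "nonempty_disjoint_families \<Omega> = {A. A \<subseteq> Pow \<Omega> \<and> {} \<notin> A \<and> disjoint A}"

end

(*
  The set of arcs of \<phi>(A) is the union of the squares X \<times> X over X in A.  If A is a family of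
  nonempty pairwise disjoint sets, then the out-neighbourhood of any point of X is X itself, so A
  is recovered as the set of nonempty out-neighbourhoods.  Perfectness follows: an element g of
  Sym(\<Omega>) maps \<sigma>(\<phi>(A)) to \<sigma>(\<phi>(B)) iff \<phi>(A^g) = \<phi>(B), and A^g is again such a family.
*)
theory Submission
  imports Defs
begin

abbreviation family_act :: "('a set set, 'a) action" where
  "family_act \<equiv> set_act (set_act point_act)"

lemma set_act_point_act: "set_act point_act X g = g ` X"
  by (simp add: set_act_def point_act_def)

lemma family_act_eq: "family_act A g = (`) g ` A"
  \<comment> \<open>The instantiation unfolds only the outer layer, leaving the inner
    \<open>set_act point_act\<close> for \<open>set_act_point_act\<close>.\<close>
  by (simp add: set_act_def[of "set_act point_act"] set_act_point_act)

text \<open>Every member lies in \<Omega>, so its square already lies in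
  \<open>\<Omega> \<times> \<Omega>\<close> and the restriction there is automatic.\<close>

lemma phi_eq:
  assumes "A \<subseteq> Pow \<Omega>"
  shows "\<phi> \<Omega> A = (\<Omega>, \<Union>X\<in>A. X \<times> X)"
  using assms by (fastforce simp: \<phi>_def)

lemma phi_in_digraphs_on: "\<phi> \<Omega> A \<in> digraphs_on \<Omega>"
  by (auto simp: \<phi>_def digraphs_on_def)

lemma family_act_closed:
  assumes "g permutes \<Omega>" "A \<subseteq> Pow \<Omega>"
  shows "family_act A g \<subseteq> Pow \<Omega>"
  using assms permutes_image[of g \<Omega>] by (auto simp: family_act_eq)

lemma phi_family_act:
  assumes "g permutes \<Omega>" "A \<subseteq> Pow \<Omega>"
  shows "\<phi> \<Omega> (family_act A g) = digraph_act (\<phi> \<Omega> A) g"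
proof -
  have "(\<Union>X\<in>family_act A g. X \<times> X) = map_prod g g ` (\<Union>X\<in>A. X \<times> X)"
    by (simp add: family_act_eq image_UN map_prod_surj_on)
  with assms show ?thesis
    by (simp add: phi_eq family_act_closed digraph_act_def permutes_image)
qed

lemma nonempty_disjoint_families_subset: "nonempty_disjoint_families \<Omega> \<subseteq> Pow (Pow \<Omega>)"
  by (auto simp: nonempty_disjoint_families_def)

text \<open>Injectivity of \<open>g\<close> preserves disjointness. This keeps A^g inside the domain
  on which \<phi> is injective.\<close>

lemma family_act_nonempty_disjoint_families:
  assumes g: "g permutes \<Omega>" and A: "A \<in> nonempty_disjoint_families \<Omega>"
  shows "family_act A g \<in> nonempty_disjoint_families \<Omega>"
proof -
  have "disjoint ((`) g ` A)"
  proof (rule disjoint_image)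
    show "inj_on g (\<Union>A)"
      using permutes_inj_on[OF g] .
    show "disjoint A"
      using A by (simp add: nonempty_disjoint_families_def)
  qed
  then show ?thesis
    using A family_act_closed[OF g, of A]
    by (auto simp: nonempty_disjoint_families_def family_act_eq)
qed

text \<open>An explicit left inverse of \<open>\<phi> \<Omega>\<close>. Taking \<alpha> from
  \<open>Domain E\<close> leaves out the points that lie in no member, whose out-neighbourhoods are
  empty.\<close>

lemma family_from_phi:
  assumes A: "A \<in> nonempty_disjoint_families \<Omega>"
  defines "E \<equiv> snd (\<phi> \<Omega> A)"
  shows "A = (\<lambda>\<alpha>. E `` {\<alpha>}) ` Domain E"
proof -
  have E: "E = (\<Union>X\<in>A. X \<times> X)"
    using A by (simp add: E_def phi_eq nonempty_disjoint_families_def)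
  \<comment> \<open>By disjointness \<alpha> lies in no other member, so only the square of
    \<open>X\<close> contributes arcs leaving \<alpha>.\<close>
  have nbhd: "E `` {\<alpha>} = X" if "X \<in> A" "\<alpha> \<in> X" for X \<alpha>
  proof -
    have "disjoint A"
      using A by (simp add: nonempty_disjoint_families_def)
    then have "Y = X" if "Y \<in> A" "\<alpha> \<in> Y" for Y
      using that \<open>X \<in> A\<close> \<open>\<alpha> \<in> X\<close> by (meson disjointD disjoint_iff)
    then show ?thesis
      using that unfolding E by blast
  qed
  have dom: "Domain E = \<Union>A"
    by (auto simp: E)
  show ?thesis
  proof (intro subset_antisym subsetI)
    fix X assume X: "X \<in> A"
    \<comment> \<open>Nonemptiness of the members enters here: it supplies a point whose
      out-neighbourhood is \<open>X\<close>.\<close>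
    with A obtain \<alpha> where "\<alpha> \<in> X"
      by (force simp: nonempty_disjoint_families_def)
    with X have "\<alpha> \<in> Domain E" and "X = E `` {\<alpha>}"
      by (auto simp only: dom nbhd)
    then show "X \<in> (\<lambda>\<alpha>. E `` {\<alpha>}) ` Domain E"
      by (rule rev_image_eqI)
  next
    fix X assume "X \<in> (\<lambda>\<alpha>. E `` {\<alpha>}) ` Domain E"
    then obtain \<alpha> Y where "X = E `` {\<alpha>}" "\<alpha> \<in> Y" "Y \<in> A"
      unfolding dom by (elim imageE UnionE)
    then show "X \<in> A"
      by (simp only: nbhd)
  qed
qed

lemma inj_on_phi: "inj_on (\<phi> \<Omega>) (nonempty_disjoint_families \<Omega>)"
proof (rule inj_onI)
  fix A B
  assume A: "A \<in> nonempty_disjoint_families \<Omega>" and B: "B \<in> nonempty_disjoint_families \<Omega>"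
    and eq: "\<phi> \<Omega> A = \<phi> \<Omega> B"
  show "A = B"
    \<comment> \<open>The recovery formula sees a family only through its digraph. It contains its
      own left-hand side, hence single \<open>subst\<close> steps.\<close>
    by (subst family_from_phi[OF A], subst family_from_phi[OF B]) (simp only: eq)
qed

lemma sigma_in_labelled_digraphs_on:
  "\<Gamma> \<in> digraphs_on \<Omega> \<Longrightarrow> \<sigma> c \<Gamma> \<in> labelled_digraphs_on \<Omega>"
  by (auto simp: \<sigma>_def labelled_digraphs_on_def digraphs_on_def split: if_splits)

lemma inj_sigma: "inj (\<sigma> c)"
  by (rule injI) (auto simp: \<sigma>_def split: prod.splits)

text \<open>With a single label, a labelling is determined by its domain. Composing with the inverse
  turns the domain into a preimage under \<open>inv g\<close>, which for bijective \<open>g\<close>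
  is the image under \<open>g\<close>.\<close>

lemma sigma_digraph_act:
  assumes "bij g"
  shows "labelled_digraph_act (\<sigma> c \<Gamma>) g = \<sigma> c (digraph_act \<Gamma> g)"
proof (cases \<Gamma>)
  case (Pair V A)
  have V: "inv g v \<in> V \<longleftrightarrow> v \<in> g ` V" for v
    using bij_image_Collect_eq[OF assms, of "\<lambda>x. x \<in> V"] by simp
  \<comment> \<open>Inverting componentwise lets the argument for vertices be repeated for
    arcs.\<close>
  have "bij (map_prod g g)" and "inv (map_prod g g) = map_prod (inv g) (inv g)"
  proof -
    have "map_prod g g \<circ> map_prod (inv g) (inv g) = id"
      and "map_prod (inv g) (inv g) \<circ> map_prod g g = id"
      using assms by (simp_all add: map_prod_compose[symmetric] bij_is_inj bij_is_surj
          surj_iff[THEN iffD1] inv_o_cancel map_prod.id)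
    then show "bij (map_prod g g)" and "inv (map_prod g g) = map_prod (inv g) (inv g)"
      by (metis o_bij, metis inv_unique_comp)
  qed
  then have A: "map_prod (inv g) (inv g) e \<in> A \<longleftrightarrow> e \<in> map_prod g g ` A" for e
    using bij_image_Collect_eq[of "map_prod g g" "\<lambda>x. x \<in> A"] by simp
  show ?thesis
    by (simp add: Pair labelled_digraph_act_def digraph_act_def \<sigma>_def comp_def V A)
qed

text \<open>Since \<sigma> commutes with renaming and is injective, it cancels, which reduces the
  question to unlabelled digraphs.\<close>

lemma sigma_phi_transp:
  assumes g: "g \<in> Sym \<Omega>" and A: "A \<subseteq> Pow \<Omega>"
  shows "labelled_digraph_act (\<sigma> c (\<phi> \<Omega> A)) g = \<sigma> c (\<phi> \<Omega> B)
           \<longleftrightarrow> \<phi> \<Omega> (family_act A g) = \<phi> \<Omega> B"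
  using g A
  by (simp add: Sym_def sigma_digraph_act permutes_bij phi_family_act inj_eq[OF inj_sigma])

lemma refiner_sigma_phi:
  fixes c :: 'l
  assumes "A \<subseteq> Pow \<Omega>"
  shows "refiner \<Omega> (labelled_digraphs_on \<Omega> :: ('a, 'l) labelled_digraph set) labelled_digraph_act
           (Transp \<Omega> family_act A B) (\<lambda>_. [\<sigma> c (\<phi> \<Omega> A)], \<lambda>_. [\<sigma> c (\<phi> \<Omega> B)])"
  using sigma_phi_transp[OF _ assms, of _ c B]
  by (auto simp: refiner_def Transp_def list_act_def sigma_in_labelled_digraphs_on
      phi_in_digraphs_on)

lemma perfect_refiner_sigma_phi:
  fixes c :: 'l
  assumes A: "A \<in> nonempty_disjoint_families \<Omega>" and B: "B \<in> nonempty_disjoint_families \<Omega>"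
  shows "perfect_refiner \<Omega> (labelled_digraphs_on \<Omega> :: ('a, 'l) labelled_digraph set)
           labelled_digraph_act (Transp \<Omega> family_act A B)
           (\<lambda>_. [\<sigma> c (\<phi> \<Omega> A)], \<lambda>_. [\<sigma> c (\<phi> \<Omega> B)])"
proof -
  have A': "A \<subseteq> Pow \<Omega>"
    using A nonempty_disjoint_families_subset by blast
  have transp: "labelled_digraph_act (\<sigma> c (\<phi> \<Omega> A)) g = \<sigma> c (\<phi> \<Omega> B) \<longleftrightarrow> family_act A g = B"
    if g: "g \<in> Sym \<Omega>" for g
  proof -
    have "family_act A g \<in> nonempty_disjoint_families \<Omega>"
      using g A by (simp add: Sym_def family_act_nonempty_disjoint_families)
    then have "\<phi> \<Omega> (family_act A g) = \<phi> \<Omega> B \<longleftrightarrow> family_act A g = B"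
      by (rule inj_on_eq_iff[OF inj_on_phi _ B])
    with sigma_phi_transp[OF g A'] show ?thesis
      by metis
  qed
  have transp_stacks: "Transp \<Omega> family_act A B \<inter> Transp \<Omega> (list_act labelled_digraph_act) S T
          = Transp \<Omega> (list_act labelled_digraph_act) (S @ [\<sigma> c (\<phi> \<Omega> A)]) (T @ [\<sigma> c (\<phi> \<Omega> B)])"
    for S T
    \<comment> \<open>Comparing last entries separates the appended digraph from the stacks;
      \<open>conj_cong\<close> makes \<open>g \<in> Sym \<Omega>\<close> available to the
      conditional rule \<open>transp\<close>.\<close>
    by (rule set_eqI) (simp add: Transp_def list_act_def transp conj_ac cong: conj_cong)
  show ?thesis
    unfolding perfect_refiner_def split_conv
    by (intro conjI ballI impI) (rule refiner_sigma_phi[OF A'] transp_stacks)+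
qed

theorem mainTheorem7:
  fixes \<Omega> :: "'a set" and c :: 'l
  assumes "finite \<Omega>" and "\<Omega> \<noteq> {}"
  shows "Sym_invariant \<Omega> (Pow (Pow \<Omega>)) (set_act (set_act point_act))
           (digraphs_on \<Omega>) digraph_act (\<phi> \<Omega>)
       \<and> inj_on (\<phi> \<Omega>) (nonempty_disjoint_families \<Omega>)
       \<and> (\<forall>A\<in>Pow (Pow \<Omega>). \<forall>B\<in>Pow (Pow \<Omega>).
            refiner \<Omega> (labelled_digraphs_on \<Omega> :: ('a, 'l) labelled_digraph set) labelled_digraph_act
              (Transp \<Omega> (set_act (set_act point_act)) A B)
              (\<lambda>_. [\<sigma> c (\<phi> \<Omega> A)], \<lambda>_. [\<sigma> c (\<phi> \<Omega> B)]))
       \<and> (\<forall>A\<in>nonempty_disjoint_families \<Omega>. \<forall>B\<in>nonempty_disjoint_families \<Omega>.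
            perfect_refiner \<Omega> (labelled_digraphs_on \<Omega> :: ('a, 'l) labelled_digraph set) labelled_digraph_act
              (Transp \<Omega> (set_act (set_act point_act)) A B)
              (\<lambda>_. [\<sigma> c (\<phi> \<Omega> A)], \<lambda>_. [\<sigma> c (\<phi> \<Omega> B)]))"
proof (intro conjI ballI)
  show "Sym_invariant \<Omega> (Pow (Pow \<Omega>)) family_act (digraphs_on \<Omega>) digraph_act (\<phi> \<Omega>)"
    by (simp add: Sym_invariant_def Sym_def phi_in_digraphs_on phi_family_act)
qed (assumption | rule inj_on_phi refiner_sigma_phi perfect_refiner_sigma_phi PowD)+

end
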